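(* Let $\tau$ be a nonzero cardinal number, $p\in[1,\infty]$, and let $\varphi:\tau\to\tau$ be a map with $\sigma_\varphi(\ell^p(\tau))\subseteq\ell^p(\tau)$. Then $\sigma_\varphi\restriction_{\ell^p(\tau)}:\ell^p(\tau)\to\ell^p(\tau)$ is not a derivation, is not a Jordan derivation, and is not a Jordan triple derivation.
   Context: For a nonzero cardinal $\tau$ (regarded as the set of ordinals $\alpha<\tau$) and $p\in[1,\infty]$, $\ell^p(\tau)$ is the set of $x=(x_\alpha)_{\alpha<\tau}\in\mathbb{C}^\tau$ with $\|x\|_p<\infty$, where $\|x\|_p=(\sum_{\alpha<\tau}|x_\alpha|^p)^{1/p}$ for $p<\infty$ and $\|x\|_\infty=\sup_{\alpha<\tau}|x_\alpha|$. With the norm $\|\cdot\|_p$, pointwise sum and pointwise product it is a Banach algebra. For $\varphi:\tau\to\tau$, the generalized shift is $\sigma_\varphi:\mathbb{C}^\tau\to\mathbb{C}^\tau$, $(x_\alpha)_{\alpha<\tau}\mapsto(x_{\varphi(\alpha)})_{\alpha<\tau}$. A linear mapping $d:\mathcal{A}\to\mathcal{A}$ on a Banach algebra $\mathcal{A}$ is: a derivation if $d(ab)=d(a)b+ad(b)$ for all $a,b\in\mathcal{A}$; a Jordan derivation if $d(a^2)=d(a)a+ad(a)$ for all $a\in\mathcal{A}$; a Jordan triple derivation if $d(aba)=d(a)ba+ad(b)a+abd(a)$ for all $a,b\in\mathcal{A}$. *)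

theory Defs
  imports "HOL-Analysis.Infinite_Sum" "HOL-Library.Extended_Nonnegative_Real"
    "HOL-Library.Function_Algebras"
begin

text \<open>
  A cardinal is a cardinal order \<open>\<tau>\<close>, and its set of elements (the ordinals below it) is
  \<open>Field \<tau>\<close>. The definitions below take an arbitrary index set \<open>I\<close>. A family indexed by \<open>I\<close> is a
  function on the whole type that vanishes outside \<open>I\<close>, so the pointwise operations of
  \<open>Function_Algebras\<close> are those of the families.
\<close>

definition families :: "'i set \<Rightarrow> ('i \<Rightarrow> complex) set" where
  "families I = {x. \<forall>\<alpha>. \<alpha> \<notin> I \<longrightarrow> x \<alpha> = 0}"

text \<open>Real powers of extended nonnegative reals, intended for positive exponents only.\<close>

definition ennreal_powr :: "ennreal \<Rightarrow> real \<Rightarrow> ennreal" where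
  "ennreal_powr a r = (if a = \<infinity> then \<infinity> else ennreal (enn2real a powr r))"

text \<open>The sum is taken in \<^typ>\<open>ennreal\<close>, where every family is summable (possibly to \<open>\<infinity>\<close>).\<close>

definition lp_norm :: "ennreal \<Rightarrow> 'i set \<Rightarrow> ('i \<Rightarrow> complex) \<Rightarrow> ennreal" where
  "lp_norm p I x =
    (if p = \<infinity> then (SUP \<alpha>\<in>I. ennreal (cmod (x \<alpha>)))
     else ennreal_powr (\<Sum>\<^sub>\<infinity>\<alpha>\<in>I. ennreal (cmod (x \<alpha>) powr enn2real p)) (1 / enn2real p))"

definition lp_space :: "ennreal \<Rightarrow> 'i set \<Rightarrow> ('i \<Rightarrow> complex) set" where
  "lp_space p I = {x \<in> families I. lp_norm p I x < \<infinity>}"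

definition cscale :: "complex \<Rightarrow> ('i \<Rightarrow> complex) \<Rightarrow> 'i \<Rightarrow> complex" where
  "cscale c x = (\<lambda>\<alpha>. c * x \<alpha>)"

definition generalized_shift :: "'i set \<Rightarrow> ('i \<Rightarrow> 'i) \<Rightarrow> ('i \<Rightarrow> complex) \<Rightarrow> 'i \<Rightarrow> complex" where
  "generalized_shift I \<phi> x = (\<lambda>\<alpha>. if \<alpha> \<in> I then x (\<phi> \<alpha>) else 0)"

text \<open>
  The following notions concern maps of an algebra with carrier \<open>A\<close>, a subset of an ambient ring,
  and scalar multiplication \<open>smul\<close>. They depend only on the restriction of \<open>d\<close> to \<open>A\<close> as long as
  \<open>A\<close> is closed under the operations.
\<close>

definition linear_self_map ::
    "('k \<Rightarrow> 'a \<Rightarrow> 'a) \<Rightarrow> 'a::ring set \<Rightarrow> ('a \<Rightarrow> 'a) \<Rightarrow> bool" where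
  "linear_self_map smul A d \<longleftrightarrow>
    d ` A \<subseteq> A \<and>
    (\<forall>a\<in>A. \<forall>b\<in>A. d (a + b) = d a + d b) \<and>
    (\<forall>c. \<forall>a\<in>A. d (smul c a) = smul c (d a))"

lemma linear_self_map_generalized_shift:
  assumes "generalized_shift I \<phi> ` A \<subseteq> A"
  shows "linear_self_map cscale A (generalized_shift I \<phi>)"
  using assms
  by (auto simp: linear_self_map_def generalized_shift_def cscale_def fun_eq_iff)

definition derivation ::
    "('k \<Rightarrow> 'a \<Rightarrow> 'a) \<Rightarrow> 'a::ring set \<Rightarrow> ('a \<Rightarrow> 'a) \<Rightarrow> bool" where
  "derivation smul A d \<longleftrightarrow> linear_self_map smul A d \<and>
    (\<forall>a\<in>A. \<forall>b\<in>A. d (a * b) = d a * b + a * d b)"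

definition jordan_derivation ::
    "('k \<Rightarrow> 'a \<Rightarrow> 'a) \<Rightarrow> 'a::ring set \<Rightarrow> ('a \<Rightarrow> 'a) \<Rightarrow> bool" where
  "jordan_derivation smul A d \<longleftrightarrow> linear_self_map smul A d \<and>
    (\<forall>a\<in>A. d (a * a) = d a * a + a * d a)"

definition jordan_triple_derivation ::
    "('k \<Rightarrow> 'a \<Rightarrow> 'a) \<Rightarrow> 'a::ring set \<Rightarrow> ('a \<Rightarrow> 'a) \<Rightarrow> bool" where
  "jordan_triple_derivation smul A d \<longleftrightarrow> linear_self_map smul A d \<and>
    (\<forall>a\<in>A. \<forall>b\<in>A. d (a * b * a) = d a * b * a + a * d b * a + a * b * d a)"

end

theory Submission imports Defs begin

text \<open>
  Let \<open>e\<close> be the indicator of \<open>\<phi> \<theta>\<close>, an idempotent with \<open>\<sigma>\<^sub>\<phi> e = 1\<close> at \<open>\<theta>\<close>. At the coordinate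
  \<open>\<theta>\<close>, the Jordan identity for \<open>e\<close> gives \<open>1 = 2 e \<theta>\<close> and the Jordan triple identity for \<open>e, e\<close>
  gives \<open>1 = 3 (e \<theta>)\<^sup>2\<close>. Both are impossible because \<open>e \<theta>\<close> is \<open>0\<close> or \<open>1\<close>.
\<close>

lemma indicator_singleton_in_lp_space:
  assumes "\<beta> \<in> I"
  shows "indicator {\<beta>} \<in> lp_space p I"
proof -
  \<comment> \<open>\<open>0 powr r\<close> is 0 for every real \<open>r\<close>, even for
    \<open>r = 0\<close>, so all terms off \<beta> vanish whatever the exponent.\<close>
  have "(\<Sum>\<^sub>\<infinity>\<alpha>\<in>I. ennreal (cmod (indicator {\<beta>} \<alpha>) powr r))
      = (\<Sum>\<^sub>\<infinity>\<alpha>\<in>{\<beta>}. ennreal (cmod (indicator {\<beta>} \<alpha>) powr r))" for r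
    using assms by (intro infsum_cong_neutral) auto
  then have sum: "(\<Sum>\<^sub>\<infinity>\<alpha>\<in>I. ennreal (cmod (indicator {\<beta>} \<alpha>) powr r)) = 1" for r
    by simp
  \<comment> \<open>This serves the case \<open>p = \<infinity>\<close>; membership asks only for
    finiteness, so a bound is enough.\<close>
  have "(SUP \<alpha>\<in>I. ennreal (cmod (indicator {\<beta>} \<alpha>))) \<le> 1"
    by (intro SUP_least) (simp add: indicator_def)
  then have sup: "(SUP \<alpha>\<in>I. ennreal (cmod (indicator {\<beta>} \<alpha>))) < \<infinity>"
    by (simp add: le_less_trans)
  show ?thesis
    using assms sup
    by (auto simp: lp_space_def families_def lp_norm_def ennreal_powr_def sum indicator_eq_0_iff)
qed

text \<open>Equal factors in the product rule; this reduces the claim on derivations to the one on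
  Jordan derivations.\<close>

lemma derivation_imp_jordan_derivation:
  "derivation smul A d \<Longrightarrow> jordan_derivation smul A d"
  by (simp add: derivation_def jordan_derivation_def)

text \<open>The identity is tested on a single idempotent, so \<open>A\<close> may be any set that
  contains it.\<close>

lemma generalized_shift_not_jordan_derivation:
  assumes "\<theta> \<in> I" and "indicator {\<phi> \<theta>} \<in> A"
  shows "\<not> jordan_derivation smul A (generalized_shift I \<phi>)"
proof
  let ?e = "indicator {\<phi> \<theta>} :: 'a \<Rightarrow> complex"
  assume "jordan_derivation smul A (generalized_shift I \<phi>)"
  then have "generalized_shift I \<phi> (?e * ?e)
      = generalized_shift I \<phi> ?e * ?e + ?e * generalized_shift I \<phi> ?e"
    using assms(2) unfolding jordan_derivation_def by blast
  from fun_cong[OF this, of \<theta>] assms(1) show False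
    \<comment> \<open>At a fixed point \<theta> of \<phi> the identity reads 1 = 2, otherwise 1 =
      0.\<close>
    by (cases "\<theta> = \<phi> \<theta>") (auto simp: generalized_shift_def indicator_def)
qed

lemma generalized_shift_not_jordan_triple_derivation:
  assumes "\<theta> \<in> I" and "indicator {\<phi> \<theta>} \<in> A"
  shows "\<not> jordan_triple_derivation smul A (generalized_shift I \<phi>)"
proof
  let ?e = "indicator {\<phi> \<theta>} :: 'a \<Rightarrow> complex"
  assume "jordan_triple_derivation smul A (generalized_shift I \<phi>)"
  then have "generalized_shift I \<phi> (?e * ?e * ?e)
      = generalized_shift I \<phi> ?e * ?e * ?e + ?e * generalized_shift I \<phi> ?e * ?e
        + ?e * ?e * generalized_shift I \<phi> ?e"
    using assms(2) unfolding jordan_triple_derivation_def by blast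
  from fun_cong[OF this, of \<theta>] assms(1) show False
    \<comment> \<open>Here the two cases read 1 = 3 and 1 = 0.\<close>
    by (cases "\<theta> = \<phi> \<theta>") (auto simp: generalized_shift_def indicator_def)
qed

theorem corollary2p4:
  fixes \<tau> :: "'i rel" and p :: ennreal and \<phi> :: "'i \<Rightarrow> 'i"
  assumes "Card_order \<tau>" and "Field \<tau> \<noteq> {}"
    and "1 \<le> p"
    and "\<phi> \<in> Field \<tau> \<rightarrow> Field \<tau>"
    and "generalized_shift (Field \<tau>) \<phi> ` lp_space p (Field \<tau>) \<subseteq> lp_space p (Field \<tau>)"
  shows "\<not> derivation cscale (lp_space p (Field \<tau>)) (generalized_shift (Field \<tau>) \<phi>)
    \<and> \<not> jordan_derivation cscale (lp_space p (Field \<tau>)) (generalized_shift (Field \<tau>) \<phi>)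
    \<and> \<not> jordan_triple_derivation cscale (lp_space p (Field \<tau>)) (generalized_shift (Field \<tau>) \<phi>)"
proof -
  obtain \<theta> where \<theta>: "\<theta> \<in> Field \<tau>"
    using assms(2) by blast
  \<comment> \<open>As \<phi> maps \<open>Field \<tau>\<close> to itself, the indicator of \<phi>
    \<theta> vanishes outside \<open>Field \<tau>\<close>.\<close>
  then have e: "indicator {\<phi> \<theta>} \<in> lp_space p (Field \<tau>)"
    using assms(4) by (intro indicator_singleton_in_lp_space) blast
  show ?thesis
    using generalized_shift_not_jordan_derivation[where \<phi> = \<phi>, OF \<theta> e]
      generalized_shift_not_jordan_triple_derivation[where \<phi> = \<phi>, OF \<theta> e]
      derivation_imp_jordan_derivation by blast
qed

end
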